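(* Let $(G,(J_v)_{v\in V},(O_v)_{v\in V},(T_e)_{e\in E})$ be a simple GIFS which satisfies bounded distortion and contractibility of the sets $J_v$. Put $$\overline{s}:=\inf\{s\ge 0 : P(s\varphi^V)\le 0\},$$ $$c:=\inf\Big\{s\ge 0 : \sum_{v\in V}\ \sup_{v'\in V:\,vv'\in E}\ \sup_{x\in K\cap J_{v'}}\|T_{vv'}'(x)\|^{s}<\infty\Big\}.$$ Then $\dim_H K\le \max(\overline{s},c)$.
   Context: Fix an integer $D\ge 1$; $|\cdot|$ is the Euclidean norm on $\mathbb{R}^D$, $\|\cdot\|$ the operator norm, $\dim_H$ the Hausdorff dimension. Conventions: suprema of nonnegative quantities over empty sets are $0$, $\inf\emptyset=+\infty$, $\log 0=-\infty$. A GIFS is a system $(G,(J_v)_{v\in V},(O_v)_{v\in V},(T_e)_{e\in E})$ such that: (1) $G=(V,E,i,t)$ is a directed multigraph with countable (finite or infinite) vertex set $V$ and countable edge set $E$, where $i(e),t(e)\in V$ are the initial and terminal vertices of $e\in E$; (2) each $J_v\subset\mathbb{R}^D$ is compact and connected, equals the closure of its interior, and $\sup_v\operatorname{diam}(J_v)<\infty$; (3) each $O_v\subset\mathbb{R}^D$ is bounded, open and connected, and $\inf_v\operatorname{dist}(J_v,\mathbb{R}^D\setminus O_v)>0$; (4) each $T_e$ is a $C^1$-diffeomorphism from $O_{t(e)}$ onto an open subset of $O_{i(e)}$ with $T_e(J_{t(e)})\subset J_{i(e)}$, and there is $r\in(0,1)$ with $\sup_{e\in E}\sup_{x\in O_{t(e)}}\|T_e'(x)\|\le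 r$. The GIFS is simple if for all $v,u\in V$ there is at most one edge from $v$ to $u$; then $E\subset V\times V$, and the edge from $v$ to $u$ is written $vu$, with map $T_{vu}:O_u\to O_v$. No connectivity of $G$ is assumed. For a simple GIFS let $X=\{\omega=\omega_0\omega_1\cdots\in V^{\mathbb{Z}_{\ge0}}:\omega_n\omega_{n+1}\in E\ \text{for all } n\ge 0\}$, let $\sigma$ be the shift $(\sigma\omega)_n=\omega_{n+1}$, define $\pi:X\to\mathbb{R}^D$ by $\{\pi\omega\}=\bigcap_{k\ge0}T_{\omega_0\omega_1}\circ\cdots\circ T_{\omega_k\omega_{k+1}}(J_{\omega_{k+1}})$, and let $K=\pi(X)$ be the limit set. Put $\varphi^V(\omega)=\log\|T_{\omega_0\omega_1}'(\pi\sigma\omega)\|$ for $\omega\in X$. For a real function $f$ on $X$ the topological pressure is $P(f)=\lim_{n\to\infty}\frac1n\log\sum_{w\in V^n:[w]\ne\emptyset}\exp(\sup_{\omega\in[w]}\sum_{i=0}^{n-1}f(\sigma^i\omega))$, where $[w]=\{\omega\in X:\omega_0\cdots\omega_{n-1}=w\}$. Bounded distortion: there exist $c_1>0$ and $0<\beta\le1$ such that $\big|\|T_e'(x)\|-\|T_e'(y)\|\big|\le c_1\|T_e'(x)\|\,|x-y|^\beta$ for all $e\in E$ and $x,y\in O_{t(e)}$. Contractibility of the sets $J_v$: there exists $c_2>0$ such that $\operatorname{diam}J_v\le c_2\sup_{e\in E:\,i(e)=v}\sup_{z\in J_{t(e)}}\|T_e'(z)\|$ for every $v\in V$. *)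

theory Defs
  imports "HOL-Analysis.Analysis" "Graph_Theory.Digraph"
begin

section \<open>Hausdorff dimension\<close>

text \<open>
  The weight \<open>(diam U)\<^sup>s\<close> of a covering set, with the conventions that the empty set has
  weight \<open>0\<close> and that \<open>0\<^sup>0 = 1\<close> (whereas \<^term>\<open>0 powr 0 = (0::real)\<close> in HOL).
\<close>

definition diam_power :: "real \<Rightarrow> 'a::metric_space set \<Rightarrow> ennreal" where
  "diam_power s U = (if U = {} then 0 else if s = 0 then 1 else ennreal (diameter U powr s))"

text \<open>
  Boundedness of the covering sets is required explicitly because \<^const>\<open>diameter\<close> is
  meaningless on unbounded sets.
\<close>

definition hausdorff_premeasure :: "real \<Rightarrow> real \<Rightarrow> 'a::metric_space set \<Rightarrow> ennreal" where
  "hausdorff_premeasure s \<delta> A =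
     Inf {(\<Sum>i. diam_power s (U i)) | U :: nat \<Rightarrow> 'a set.
            A \<subseteq> (\<Union>i. U i) \<and> (\<forall>i. bounded (U i) \<and> diameter (U i) \<le> \<delta>)}"

definition hausdorff_measure :: "real \<Rightarrow> 'a::metric_space set \<Rightarrow> ennreal" where
  "hausdorff_measure s A = (SUP \<delta>\<in>{0<..}. hausdorff_premeasure s \<delta> A)"

definition hausdorff_dim :: "'a::metric_space set \<Rightarrow> ereal" where
  "hausdorff_dim A = Inf (ereal ` {s. 0 \<le> s \<and> hausdorff_measure s A = 0})"

section \<open>Diffeomorphisms\<close>

definition C1_on :: "'a::real_normed_vector set \<Rightarrow> ('a \<Rightarrow> 'b::real_normed_vector) \<Rightarrow> bool" where
  "C1_on U f \<longleftrightarrow>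
     (\<exists>f' :: 'a \<Rightarrow> 'a \<Rightarrow>\<^sub>L 'b.
        (\<forall>x\<in>U. (f has_derivative blinfun_apply (f' x)) (at x)) \<and> continuous_on U f')"

definition C1_diffeo_onto_image ::
    "'a::real_normed_vector set \<Rightarrow> ('a \<Rightarrow> 'b::real_normed_vector) \<Rightarrow> bool" where
  "C1_diffeo_onto_image U f \<longleftrightarrow>
     inj_on f U \<and> open (f ` U) \<and> C1_on U f \<and> C1_on (f ` U) (inv_into U f)"

definition deriv_norm :: "('a::real_normed_vector \<Rightarrow> 'b::real_normed_vector) \<Rightarrow> 'a \<Rightarrow> real" where
  "deriv_norm f x = onorm (frechet_derivative f (at x))"

section \<open>Graph iterated function systems\<close>

text \<open>
  The initial and terminal vertex of an edge are \<^const>\<open>tail\<close> and \<^const>\<open>head\<close>.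
  Each \<open>T e\<close> is a total function of which only the restriction to \<open>U (head G e)\<close> matters.
\<close>

locale gifs = wf_digraph G
  for G :: "('v, 'e) pre_digraph" (structure) +
  fixes J U :: "'v \<Rightarrow> (real ^ 'n) set"
    and T :: "'e \<Rightarrow> real ^ 'n \<Rightarrow> real ^ 'n"
  assumes countable_verts: "countable (verts G)"
    and countable_arcs: "countable (arcs G)"
    and J_nonempty: "v \<in> verts G \<Longrightarrow> J v \<noteq> {}"
    and J_compact: "v \<in> verts G \<Longrightarrow> compact (J v)"
    and J_connected: "v \<in> verts G \<Longrightarrow> connected (J v)"
    and J_regular: "v \<in> verts G \<Longrightarrow> closure (interior (J v)) = J v"
    and J_diameter: "\<exists>B. \<forall>v\<in>verts G. diameter (J v) \<le> B"
    and U_bounded: "v \<in> verts G \<Longrightarrow> bounded (U v)"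
    and U_open: "v \<in> verts G \<Longrightarrow> open (U v)"
    and U_connected: "v \<in> verts G \<Longrightarrow> connected (U v)"
    and J_U_dist: "\<exists>\<delta>>0. \<forall>v\<in>verts G. \<delta> \<le> setdist (J v) (- U v)"
    and T_diffeo: "e \<in> arcs G \<Longrightarrow> C1_diffeo_onto_image (U (head G e)) (T e)"
    and T_U: "e \<in> arcs G \<Longrightarrow> T e ` U (head G e) \<subseteq> U (tail G e)"
    and T_J: "e \<in> arcs G \<Longrightarrow> T e ` J (head G e) \<subseteq> J (tail G e)"
    and T_contracting:
      "\<exists>r. 0 < r \<and> r < 1 \<and> (\<forall>e\<in>arcs G. \<forall>x\<in>U (head G e). deriv_norm (T e) x \<le> r)"

text \<open>\<^locale>\<open>nomulti_digraph\<close> forbids parallel edges but allows loops.\<close>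

locale simple_gifs = gifs + nomulti_digraph

definition bounded_distortion ::
    "('v, 'e) pre_digraph \<Rightarrow> ('v \<Rightarrow> (real ^ 'n) set) \<Rightarrow> ('e \<Rightarrow> real ^ 'n \<Rightarrow> real ^ 'n) \<Rightarrow> bool" where
  "bounded_distortion G U T \<longleftrightarrow>
     (\<exists>c1>0. \<exists>\<beta>>0. \<beta> \<le> 1 \<and>
        (\<forall>e\<in>arcs G. \<forall>x\<in>U (head G e). \<forall>y\<in>U (head G e).
           \<bar>deriv_norm (T e) x - deriv_norm (T e) y\<bar>
             \<le> c1 * deriv_norm (T e) x * norm (x - y) powr \<beta>))"

text \<open>Suprema of nonnegative quantities are taken in \<^typ>\<open>ennreal\<close>, where \<open>Sup {} = 0\<close>.\<close>

definition contractible_J ::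
    "('v, 'e) pre_digraph \<Rightarrow> ('v \<Rightarrow> (real ^ 'n) set) \<Rightarrow> ('e \<Rightarrow> real ^ 'n \<Rightarrow> real ^ 'n) \<Rightarrow> bool" where
  "contractible_J G J T \<longleftrightarrow>
     (\<exists>c2>0. \<forall>v\<in>verts G.
        ennreal (diameter (J v)) \<le>
          ennreal c2 *
            (SUP e\<in>{e \<in> arcs G. tail G e = v}. SUP z\<in>J (head G e). ennreal (deriv_norm (T e) z)))"

section \<open>Symbolic coding and limit set of a simple GIFS\<close>

definition edge :: "('v, 'e) pre_digraph \<Rightarrow> 'v \<Rightarrow> 'v \<Rightarrow> 'e" where
  "edge G v u = (THE e. e \<in> arcs G \<and> tail G e = v \<and> head G e = u)"

definition path_space :: "('v, 'e) pre_digraph \<Rightarrow> (nat \<Rightarrow> 'v) set" where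
  "path_space G = {\<omega>. \<forall>n. \<omega> n \<in> verts G \<and> \<omega> n \<rightarrow>\<^bsub>G\<^esub> \<omega> (Suc n)}"

definition shift :: "(nat \<Rightarrow> 'v) \<Rightarrow> nat \<Rightarrow> 'v" where
  "shift \<omega> = (\<lambda>n. \<omega> (Suc n))"

text \<open>\<open>path_map G T \<omega> k\<close> is the composition of \<open>T\<close> along the first \<open>k + 1\<close> edges of \<open>\<omega>\<close>.\<close>

fun path_map ::
    "('v, 'e) pre_digraph \<Rightarrow> ('e \<Rightarrow> 'a \<Rightarrow> 'a) \<Rightarrow> (nat \<Rightarrow> 'v) \<Rightarrow> nat \<Rightarrow> 'a \<Rightarrow> 'a" where
  "path_map G T \<omega> 0 = T (edge G (\<omega> 0) (\<omega> 1))"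
| "path_map G T \<omega> (Suc k) = path_map G T \<omega> k \<circ> T (edge G (\<omega> (Suc k)) (\<omega> (Suc (Suc k))))"

definition coding ::
    "('v, 'e) pre_digraph \<Rightarrow> ('v \<Rightarrow> 'a set) \<Rightarrow> ('e \<Rightarrow> 'a \<Rightarrow> 'a) \<Rightarrow> (nat \<Rightarrow> 'v) \<Rightarrow> 'a" where
  "coding G J T \<omega> = (THE x. (\<Inter>k. path_map G T \<omega> k ` J (\<omega> (Suc k))) = {x})"

definition limit_set ::
    "('v, 'e) pre_digraph \<Rightarrow> ('v \<Rightarrow> 'a set) \<Rightarrow> ('e \<Rightarrow> 'a \<Rightarrow> 'a) \<Rightarrow> 'a set" where
  "limit_set G J T = coding G J T ` path_space G"

definition potential ::
    "('v, 'e) pre_digraph \<Rightarrow> ('v \<Rightarrow> (real ^ 'n) set) \<Rightarrow> ('e \<Rightarrow> real ^ 'n \<Rightarrow> real ^ 'n) \<Rightarrow>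
       (nat \<Rightarrow> 'v) \<Rightarrow> real" where
  "potential G J T \<omega> = ln (deriv_norm (T (edge G (\<omega> 0) (\<omega> 1))) (coding G J T (shift \<omega>)))"

section \<open>Topological pressure\<close>

definition cylinder :: "('v, 'e) pre_digraph \<Rightarrow> 'v list \<Rightarrow> (nat \<Rightarrow> 'v) set" where
  "cylinder G w = {\<omega> \<in> path_space G. map \<omega> [0..<length w] = w}"

definition admissible_words :: "('v, 'e) pre_digraph \<Rightarrow> nat \<Rightarrow> 'v list set" where
  "admissible_words G n =
     {w. length w = n \<and> set w \<subseteq> verts G \<and> cylinder G w \<noteq> {}}"

definition birkhoff_sum :: "((nat \<Rightarrow> 'v) \<Rightarrow> real) \<Rightarrow> nat \<Rightarrow> (nat \<Rightarrow> 'v) \<Rightarrow> real" where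
  "birkhoff_sum f n \<omega> = (\<Sum>i<n. f ((shift ^^ i) \<omega>))"

text \<open>
  The supremum is taken after exponentiating, in \<^typ>\<open>ennreal\<close>, so that nothing
  is assumed about the boundedness of \<open>f\<close>; all cylinders involved are nonempty.
\<close>

definition partition_sum :: "('v, 'e) pre_digraph \<Rightarrow> ((nat \<Rightarrow> 'v) \<Rightarrow> real) \<Rightarrow> nat \<Rightarrow> ennreal" where
  "partition_sum G f n =
     (\<Sum>\<^sub>\<infinity>w\<in>admissible_words G n. SUP \<omega>\<in>cylinder G w. ennreal (exp (birkhoff_sum f n \<omega>)))"

definition log_ennreal :: "ennreal \<Rightarrow> ereal" where
  "log_ennreal x = (if x = 0 then -\<infinity> else if x = \<infinity> then \<infinity> else ereal (ln (enn2real x)))"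

text \<open>
  Without connectivity of the graph the limit defining the pressure need not exist when some
  of the partition sums are infinite. The \<open>limsup\<close> is the limit whenever there is one.
\<close>

definition pressure :: "('v, 'e) pre_digraph \<Rightarrow> ((nat \<Rightarrow> 'v) \<Rightarrow> real) \<Rightarrow> ereal" where
  "pressure G f = limsup (\<lambda>n. log_ennreal (partition_sum G f n) / ereal (real n))"

lemma pressure_eq_lim:
  assumes "(\<lambda>n. log_ennreal (partition_sum G f n) / ereal (real n)) \<longlonglongrightarrow> L"
  shows "pressure G f = L"
  unfolding pressure_def by (rule lim_imp_Limsup) (use assms in auto)

section \<open>The two critical exponents\<close>

text \<open>Both infima are taken in \<^typ>\<open>ereal\<close>, where \<open>Inf {} = \<infinity>\<close>.\<close>

definition upper_exponent ::
    "('v, 'e) pre_digraph \<Rightarrow> ('v \<Rightarrow> (real ^ 'n) set) \<Rightarrow> ('e \<Rightarrow> real ^ 'n \<Rightarrow> real ^ 'n) \<Rightarrow> ereal" where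
  "upper_exponent G J T =
     Inf (ereal ` {s. 0 \<le> s \<and> pressure G (\<lambda>\<omega>. s * potential G J T \<omega>) \<le> 0})"

definition summability_exponent ::
    "('v, 'e) pre_digraph \<Rightarrow> ('v \<Rightarrow> (real ^ 'n) set) \<Rightarrow> ('e \<Rightarrow> real ^ 'n \<Rightarrow> real ^ 'n) \<Rightarrow> ereal" where
  "summability_exponent G J T =
     Inf (ereal ` {s. 0 \<le> s \<and>
       (\<Sum>\<^sub>\<infinity>v\<in>verts G. SUP v'\<in>{v' \<in> verts G. v \<rightarrow>\<^bsub>G\<^esub> v'}. SUP x\<in>limit_set G J T \<inter> J v'.
          ennreal (deriv_norm (T (edge G v v')) x powr s)) < \<infinity>})"

end

theory Submission
  imports Defs
begin

text \<open>
  Let \<open>\<phi>\<close> be the potential, \<open>0 \<le> s < s'\<close>, and suppose that the pressure of \<open>s \<phi>\<close> is at most \<open>0\<close>.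
  The images \<open>\<pi>[w]\<close> of the cylinders of admissible words \<open>w\<close> of length \<open>n\<close> form a countable cover
  of the limit set \<open>K\<close>, and everything follows from the two bounds
  \<open>diam \<pi>[w] \<le> L * r ^ (n - 1)\<close> and \<open>diam \<pi>[w] \<le> C * exp (S\<^sub>n \<phi> \<omega>)\<close> for a suitable \<open>\<omega> \<in> [w]\<close>
  (\<open>diameter_coding_cylinder\<close>). Splitting \<open>d powr s' = d powr s * d powr (s' - s)\<close> for
  \<open>d = diam \<pi>[w]\<close>, using the second bound for the first factor and the first bound for the second
  one, the \<open>s'\<close>-weight of the cover is at most a constant times \<open>r powr ((n - 1) * (s' - s))\<close> times
  the partition sum of \<open>s \<phi>\<close>. By the assumption on the pressure this sum has no positive exponential
  growth rate, so the weight tends to \<open>0\<close> and \<open>K\<close> has \<open>s'\<close>-dimensional measure \<open>0\<close>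
  (\<open>hausdorff_measure_limit_set_eq_0\<close>).

  Three facts give the exponential bound. First, the sets \<open>J v\<close> are connected but need not be convex, so a
  derivative bound does not directly bound the diameter of an image; since they have bounded
  diameter and sit inside \<open>U v\<close> with a uniform margin, it does so up to one constant \<open>M\<close> for all
  vertices (\<open>locally_lipschitz_imp_diameter_bound\<close>). Second, bounded distortion of the single maps
  passes to compositions of any length, because two orbits along the same path approach each other
  geometrically (\<open>norm_prod_distortion\<close>). A word with \<open>n\<close> vertices has only \<open>n - 1\<close> edges, so this
  bounds \<open>diam \<pi>[w]\<close> by a multiple of \<open>exp (S\<^sub>n\<^sub>-\<^sub>1 \<phi> \<omega>) * diam (J v)\<close>, with \<open>v\<close> the last
  vertex of \<open>w\<close>. Third, contractibility replaces \<open>diam (J v)\<close> by the missing factor: it provides an edge \<open>e\<close> leaving \<open>v\<close>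
  whose derivative is comparable with \<open>diam (J v)\<close>. As \<open>diam (J v) > 0\<close>, every vertex has an outgoing
  edge; so \<open>e\<close> can be prolonged to an infinite path, which supplies the \<open>\<omega> \<in> [w]\<close> above
  (\<open>good_continuation\<close>).
\<close>

section \<open>Hausdorff measure and growth rates\<close>

text \<open>
  The premeasure only knows covers indexed by \<^typ>\<open>nat\<close>. An arbitrary countable cover is enumerated
  and padded with empty sets, which have weight \<open>0\<close>. The factor \<open>c\<close> is kept in front of the sum so
  that no scaling law for infinite sums in \<^typ>\<open>ennreal\<close> has to be invoked.
\<close>
lemma hausdorff_premeasure_le_infsum:
  fixes F :: "'i \<Rightarrow> 'a::metric_space set" and g :: "'i \<Rightarrow> ennreal"
  assumes I: "countable I" and A: "A \<subseteq> (\<Union>i\<in>I. F i)" and "0 \<le> \<delta>"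
    and F: "\<And>i. i \<in> I \<Longrightarrow> bounded (F i)" "\<And>i. i \<in> I \<Longrightarrow> diameter (F i) \<le> \<delta>"
    and g: "\<And>i. i \<in> I \<Longrightarrow> diam_power s (F i) \<le> c * g i"
  shows "hausdorff_premeasure s \<delta> A \<le> c * (\<Sum>\<^sub>\<infinity>i\<in>I. g i)"
proof -
  define U where "U n = (if n \<in> to_nat_on I ` I then F (from_nat_into I n) else {})" for n
  have U: "U (to_nat_on I i) = F i" if "i \<in> I" for i using that I by (simp add: U_def)
  have "A \<subseteq> (\<Union>n. U n)" using A U by fastforce
  moreover have "bounded (U n) \<and> diameter (U n) \<le> \<delta>" for n
  proof (cases "n \<in> to_nat_on I ` I")
    case True
    then show ?thesis using F U by auto
  next
    case False
    then show ?thesis using \<open>0 \<le> \<delta>\<close> by (simp add: U_def)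
  qed
  ultimately have "hausdorff_premeasure s \<delta> A \<le> (\<Sum>n. diam_power s (U n))"
    unfolding hausdorff_premeasure_def by (intro Inf_lower) blast
  also have "\<dots> \<le> c * (\<Sum>\<^sub>\<infinity>i\<in>I. g i)"
  proof (rule suminf_le_const)
    fix n
    define Q where "Q = {i \<in> I. to_nat_on I i < n}"
    have inj: "inj_on (to_nat_on I) Q"
      using inj_on_to_nat_on[OF I] by (rule inj_on_subset) (auto simp: Q_def)
    have sub: "to_nat_on I ` Q \<subseteq> {..<n}" by (auto simp: Q_def)
    then have fin: "finite Q" using inj by (meson finite_imageD finite_lessThan finite_subset)
    have "(\<Sum>m<n. diam_power s (U m)) = (\<Sum>m\<in>to_nat_on I ` Q. diam_power s (U m))"
      by (rule sum.mono_neutral_right) (use sub in \<open>auto simp: U_def Q_def diam_power_def\<close>)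
    also have "\<dots> = (\<Sum>i\<in>Q. diam_power s (F i))"
      unfolding sum.reindex[OF inj] by (rule sum.cong) (auto simp: Q_def U)
    also have "\<dots> \<le> c * (\<Sum>i\<in>Q. g i)"
      unfolding sum_distrib_left by (rule sum_mono) (auto simp: Q_def g)
    also have "\<dots> \<le> c * (\<Sum>\<^sub>\<infinity>i\<in>I. g i)"
    proof (rule mult_left_mono)
      have "infsum g Q \<le> infsum g I"
        by (rule infsum_mono_neutral) (auto simp: Q_def intro!: nonneg_summable_on_complete)
      then show "(\<Sum>i\<in>Q. g i) \<le> (\<Sum>\<^sub>\<infinity>i\<in>I. g i)" using fin by simp
    qed simp
    finally show "(\<Sum>m<n. diam_power s (U m)) \<le> c * (\<Sum>\<^sub>\<infinity>i\<in>I. g i)" .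
  qed simp
  finally show ?thesis .
qed

lemma le_exp_if_log_ennreal_less:
  assumes "log_ennreal x / ereal (real n) < ereal \<epsilon>" "0 < n"
  shows "x \<le> ennreal (exp (\<epsilon> * real n))"
proof -
  consider "x = 0" | "x = \<infinity>" | y where "x = ennreal y" "0 < y"
    by (cases x) (auto simp: le_less)
  then show ?thesis
  proof cases
    case 2
    then show ?thesis using assms by (simp add: log_ennreal_def)
  next
    case 3
    then have "ln y < \<epsilon> * real n"
      using assms by (simp add: log_ennreal_def field_simps)
    then have "y \<le> exp (\<epsilon> * real n)" using 3(2) by (metis exp_le_cancel_iff exp_ln less_imp_le)
    then show ?thesis using 3 by (simp add: ennreal_leI)
  qed simp
qed

section \<open>Local Lipschitz bounds on connected sets\<close>

text \<open>
  Lebesgue measure is subadditive. This turns a count of covering intervals into a bound on length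
  and takes the place of a combinatorial chaining argument.
\<close>
lemma interval_length_le_cover:
  fixes l \<eta> :: real and c :: "'i \<Rightarrow> real"
  assumes "finite F" "0 \<le> \<eta>" "0 \<le> l" and cov: "{0..l} \<subseteq> (\<Union>a\<in>F. {c a - \<eta> .. c a + \<eta>})"
  shows "l \<le> 2 * real (card F) * \<eta>"
proof -
  have "measure lborel {0..l} \<le> measure lborel (\<Union>a\<in>F. {c a - \<eta> .. c a + \<eta>})"
    by (rule measure_mono_fmeasurable)
       (use assms in \<open>auto intro!: fmeasurable_compact compact_UN\<close>)
  also have "\<dots> \<le> (\<Sum>a\<in>F. measure lborel {c a - \<eta> .. c a + \<eta>})"
    by (rule measure_UNION_le) (use assms in auto)
  also have "\<dots> = 2 * real (card F) * \<eta>"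
    using assms by simp
  finally show ?thesis using assms by simp
qed

text \<open>
  If \<open>J\<close> is smaller than the scale \<open>\<delta>\<close>, the local bound applies directly. Otherwise \<open>\<delta> \<le> diameter J\<close>,
  and it suffices to bound the image by a multiple of \<open>K * \<delta>\<close>: a translate of \<open>J\<close> lies in a fixed
  ball of radius \<open>B\<close>, hence \<open>J\<close> is a union of boundedly many pieces of diameter below \<open>\<delta>\<close>. The
  function \<open>dist (f x) (f p)\<close> of \<open>p\<close> varies by at most \<open>K * \<delta>\<close> on each piece, while connectedness of
  \<open>J\<close> forces its values to fill the interval from \<open>0\<close> to \<open>dist (f x) (f y)\<close>. The point of the lemma
  is that \<open>M\<close> depends only on \<open>\<delta>\<close> and \<open>B\<close>.
\<close>
lemma locally_lipschitz_imp_diameter_bound: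
  fixes \<delta> B :: real
  assumes "0 < \<delta>"
  obtains M :: real where "0 < M"
    and "\<And>J (f :: 'a::euclidean_space \<Rightarrow> 'b::metric_space) K x y.
      \<lbrakk>connected J; bounded J; diameter J \<le> B; 0 \<le> K;
       \<And>p q. \<lbrakk>p \<in> J; q \<in> J; dist p q < \<delta>\<rbrakk> \<Longrightarrow> dist (f p) (f q) \<le> K * dist p q;
       x \<in> J; y \<in> J\<rbrakk> \<Longrightarrow> dist (f x) (f y) \<le> K * (M * diameter J)"
proof -
  have "compact (cball (0::'a) B)" by simp
  then obtain F where F: "finite F" "cball (0::'a) B \<subseteq> (\<Union>a\<in>F. ball a (\<delta>/2))"
    using compact_imp_seq_compact seq_compact_imp_totally_bounded assms
    by (metis half_gt_zero)
  define M where "M = 1 + 2 * real (card F)"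
  show ?thesis
  proof (rule that[of M])
    show "0 < M" by (simp add: M_def add_pos_nonneg)
  next
    fix J and f :: "'a \<Rightarrow> 'b" and K x y
    assume J: "connected J" "bounded J" "diameter J \<le> B" and K: "0 \<le> K"
      and lip: "\<And>p q. \<lbrakk>p \<in> J; q \<in> J; dist p q < \<delta>\<rbrakk> \<Longrightarrow> dist (f p) (f q) \<le> K * dist p q"
      and xy: "x \<in> J" "y \<in> J"
    have d0: "0 \<le> diameter J" using J(2) by (rule diameter_ge_0)
    have dd: "dist p q \<le> diameter J" if "p \<in> J" "q \<in> J" for p q
      using diameter_bounded_bound[OF J(2) that] .
    show "dist (f x) (f y) \<le> K * (M * diameter J)"
    proof (cases "diameter J < \<delta>")
      case True
      then have "dist (f x) (f y) \<le> K * dist x y"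
        using lip[OF xy] dd[OF xy] by simp
      also have "\<dots> \<le> K * (1 * diameter J)" using dd[OF xy] K by (simp add: mult_left_mono)
      also have "\<dots> \<le> K * (M * diameter J)"
        using K d0 by (intro mult_left_mono mult_right_mono) (auto simp: M_def)
      finally show ?thesis .
    next
      case False
      have cont: "continuous_on J f"
        unfolding continuous_on_iff
      proof (intro ballI allI impI)
        fix p e assume p: "p \<in> J" and e: "(0::real) < e"
        define d where "d = min \<delta> (e / (K + 1))"
        have d: "0 < d" using e K assms by (auto simp: d_def)
        have "dist (f q) (f p) < e" if q: "q \<in> J" "dist q p < d" for q
        proof -
          have "dist (f q) (f p) \<le> K * dist q p" using lip[of q p] p q by (auto simp: d_def)
          also have "\<dots> \<le> K * (e / (K + 1))"
            using q K by (intro mult_left_mono) (auto simp: d_def)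
          also have "\<dots> < e" using K e by (simp add: field_simps)
          finally show ?thesis .
        qed
        then show "\<exists>d>0. \<forall>q\<in>J. dist q p < d \<longrightarrow> dist (f q) (f p) < e" using d by blast
      qed
      define h where "h p = dist (f x) (f p)" for p
      have "connected (h ` J)"
        unfolding h_def by (intro connected_continuous_image J continuous_intros cont)
      moreover have "0 \<in> h ` J" using xy by (force simp: h_def)
      moreover have "h y \<in> h ` J" using xy by blast
      ultimately have sub: "{0..h y} \<subseteq> h ` J" by (rule connected_contains_Icc)
      \<comment> \<open>The pieces of \<open>J\<close>; \<open>c a\<close> is the value of \<open>h\<close> at some point of the piece \<open>A a\<close>.\<close>
      define A where "A a = {p \<in> J. p - x \<in> ball a (\<delta>/2)}" for a
      define c where "c a = h (SOME p. p \<in> A a)" for a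
      have "{0..h y} \<subseteq> (\<Union>a\<in>F. {c a - K * \<delta> .. c a + K * \<delta>})"
      proof
        fix t assume "t \<in> {0..h y}"
        then obtain p where p: "p \<in> J" "t = h p" using sub by blast
        have "p - x \<in> cball 0 B" using dd[OF xy(1) p(1)] J(3) by (simp add: dist_norm norm_minus_commute)
        then obtain a where a: "a \<in> F" "p - x \<in> ball a (\<delta>/2)" using F by blast
        then have pa: "p \<in> A a" using p by (simp add: A_def)
        define q where "q = (SOME p. p \<in> A a)"
        have qa: "q \<in> A a" unfolding q_def using pa by (rule someI)
        have "dist (p - x) (q - x) < \<delta>"
          using pa qa dist_triangle_half_r[of a "p - x" \<delta> "q - x"]
          by (simp add: A_def)
        then have pq: "dist p q < \<delta>" by (simp add: dist_norm)
        have "\<bar>h p - h q\<bar> \<le> dist (f p) (f q)"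
          unfolding h_def by (metis abs_dist_diff_le dist_commute)
        also have "\<dots> \<le> K * dist p q" using lip pq pa qa by (auto simp: A_def)
        also have "\<dots> \<le> K * \<delta>" using pq K by (simp add: mult_left_mono)
        finally have "\<bar>t - c a\<bar> \<le> K * \<delta>" by (simp add: p c_def q_def)
        then show "t \<in> (\<Union>a\<in>F. {c a - K * \<delta> .. c a + K * \<delta>})" using a(1) by force
      qed
      then have "h y \<le> 2 * real (card F) * (K * \<delta>)"
        using F(1) K assms by (intro interval_length_le_cover) (auto simp: h_def)
      also have "\<dots> \<le> 2 * real (card F) * (K * diameter J)"
        using False K by (intro mult_left_mono) auto
      also have "\<dots> \<le> K * (M * diameter J)"
        using K d0 by (auto simp: M_def algebra_simps)
      finally show ?thesis by (simp add: h_def)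
    qed
  qed
qed

section \<open>Compositions along a path\<close>

text \<open>
  Unlike \<^const>\<open>path_map\<close>, this counts edges from \<open>0\<close> and recurses by splitting off the first edge, so
  that induction along a path can pass to the shifted path.
\<close>
fun comp_map ::
    "('v, 'e) pre_digraph \<Rightarrow> ('e \<Rightarrow> 'a \<Rightarrow> 'a) \<Rightarrow> (nat \<Rightarrow> 'v) \<Rightarrow> nat \<Rightarrow> 'a \<Rightarrow> 'a" where
  "comp_map G T \<omega> 0 x = x"
| "comp_map G T \<omega> (Suc k) x = T (edge G (\<omega> 0) (\<omega> 1)) (comp_map G T (shift \<omega>) k x)"

text \<open>
  The chain rule bound for the derivative of \<^const>\<open>comp_map\<close> at \<open>x\<close>: the product of the norms of the
  derivatives, each taken at the point of the orbit of \<open>x\<close> where its map is applied.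
\<close>
fun norm_prod ::
    "('v, 'e) pre_digraph \<Rightarrow> ('e \<Rightarrow> 'a::real_normed_vector \<Rightarrow> 'a) \<Rightarrow> (nat \<Rightarrow> 'v) \<Rightarrow> nat \<Rightarrow> 'a \<Rightarrow> real"
  where
  "norm_prod G T \<omega> 0 x = 1"
| "norm_prod G T \<omega> (Suc k) x =
     deriv_norm (T (edge G (\<omega> 0) (\<omega> 1))) (comp_map G T (shift \<omega>) k x) * norm_prod G T (shift \<omega>) k x"

lemma funpow_shift: "(shift ^^ k) \<omega> i = \<omega> (k + i)"
  by (induction k arbitrary: \<omega> i) (simp_all add: shift_def funpow_swap1)

lemma shift_apply: "shift \<omega> i = \<omega> (Suc i)"
  by (simp add: shift_def)

lemma shift_path_space: "\<omega> \<in> path_space G \<Longrightarrow> shift \<omega> \<in> path_space G"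
  by (simp add: path_space_def shift_apply)

lemma funpow_shift_path_space: "\<omega> \<in> path_space G \<Longrightarrow> (shift ^^ k) \<omega> \<in> path_space G"
  by (induction k) (simp_all add: shift_path_space)

lemma path_map_Suc:
  "path_map G T \<omega> (Suc k) = T (edge G (\<omega> 0) (\<omega> 1)) \<circ> path_map G T (shift \<omega>) k"
  by (induction k arbitrary: \<omega>) (simp_all add: shift_apply fun_eq_iff)

lemma path_map_eq_comp_map: "path_map G T \<omega> k = comp_map G T \<omega> (Suc k)"
proof (induction k arbitrary: \<omega>)
  case (Suc k)
  show ?case unfolding path_map_Suc Suc by (simp add: fun_eq_iff)
qed (simp add: fun_eq_iff)

lemma comp_map_cong:
  "(\<And>i. i \<le> k \<Longrightarrow> \<omega> i = \<omega>' i) \<Longrightarrow> comp_map G T \<omega> k x = comp_map G T \<omega>' k x"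
proof (induction k arbitrary: \<omega> \<omega>')
  case (Suc k)
  have "comp_map G T (shift \<omega>) k x = comp_map G T (shift \<omega>') k x"
    by (rule Suc.IH) (use Suc.prems in \<open>simp add: shift_apply\<close>)
  then show ?case using Suc.prems[of 0] Suc.prems[of 1] by simp
qed simp

text \<open>The reason why distortion factors that are geometrically close to \<open>1\<close> have a bounded product.\<close>
lemma prod_one_plus_geometric_le:
  fixes a \<rho> :: real
  assumes "0 \<le> a" "0 \<le> \<rho>" "\<rho> < 1"
  shows "(\<Prod>i<k. 1 + a * \<rho> ^ i) \<le> exp (a / (1 - \<rho>))"
proof -
  have "(\<Prod>i<k. 1 + a * \<rho> ^ i) \<le> (\<Prod>i<k. exp (a * \<rho> ^ i))"
    using assms by (intro prod_mono) (auto intro: add_nonneg_nonneg exp_ge_add_one_self)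
  also have "\<dots> = exp (a * (\<Sum>i<k. \<rho> ^ i))" by (simp add: exp_sum sum_distrib_left)
  also have "\<dots> \<le> exp (a / (1 - \<rho>))"
  proof -
    have "(\<Sum>i<k. \<rho> ^ i) \<le> (\<Sum>i. \<rho> ^ i)"
      using assms by (intro sum_le_suminf) auto
    also have "\<dots> = 1 / (1 - \<rho>)" using assms by (intro suminf_geometric) auto
    finally have "a * (\<Sum>i<k. \<rho> ^ i) \<le> a * (1 / (1 - \<rho>))" using assms by (intro mult_left_mono) auto
    then show ?thesis by simp
  qed
  finally show ?thesis .
qed

section \<open>Geometric estimates\<close>

text \<open>
  The hypotheses of the theorem with all their constants fixed: \<open>B\<close> bounds the diameters, \<open>\<delta>\<close> is the
  margin of \<open>J v\<close> in \<open>U v\<close>, and \<open>M\<close> comes from \<open>locally_lipschitz_imp_diameter_bound\<close>. This locale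
  loses no generality, see \<open>simple_gifs_imp_uniform_gifs\<close> below.
\<close>
locale uniform_gifs = simple_gifs G J U T
  for G :: "('v, 'e) pre_digraph" and J U :: "'v \<Rightarrow> (real ^ 'n) set"
    and T :: "'e \<Rightarrow> real ^ 'n \<Rightarrow> real ^ 'n" +
  fixes B \<delta> r M c1 \<beta> c2 :: real
  assumes B_nonneg: "0 \<le> B"
    and diameter_le_B: "v \<in> verts G \<Longrightarrow> diameter (J v) \<le> B"
    and \<delta>_pos: "0 < \<delta>"
    and ball_subset_U: "\<lbrakk>v \<in> verts G; p \<in> J v\<rbrakk> \<Longrightarrow> ball p \<delta> \<subseteq> U v"
    and r_bounds: "0 < r" "r < 1"
    and deriv_norm_le_r: "\<lbrakk>e \<in> arcs G; x \<in> U (head G e)\<rbrakk> \<Longrightarrow> deriv_norm (T e) x \<le> r"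
    and M_pos: "0 < M"
    and M_bound: "\<lbrakk>v \<in> verts G; 0 \<le> K;
       \<And>p q. \<lbrakk>p \<in> J v; q \<in> J v; dist p q < \<delta>\<rbrakk> \<Longrightarrow> dist (f p) (f q) \<le> K * dist p q;
       x \<in> J v; y \<in> J v\<rbrakk> \<Longrightarrow> dist (f x) (f y :: real ^ 'n) \<le> K * (M * diameter (J v))"
    and distortion_bounds: "0 < c1" "0 < \<beta>"
    and distortion: "\<lbrakk>e \<in> arcs G; x \<in> U (head G e); y \<in> U (head G e)\<rbrakk> \<Longrightarrow>
       \<bar>deriv_norm (T e) x - deriv_norm (T e) y\<bar> \<le> c1 * deriv_norm (T e) x * norm (x - y) powr \<beta>"
    and c2_pos: "0 < c2"
    and contractible: "v \<in> verts G \<Longrightarrow> ennreal (diameter (J v)) \<le> ennreal c2 *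
       (SUP e\<in>{e \<in> arcs G. tail G e = v}. SUP z\<in>J (head G e). ennreal (deriv_norm (T e) z))"
begin

lemma edge_eq: "e \<in> arcs G \<Longrightarrow> edge G (tail G e) (head G e) = e"
  unfolding edge_def
  by (rule the_equality) (auto intro: no_multi_arcs simp: arc_to_ends_def)

lemma dominates_arc: "e \<in> arcs G \<Longrightarrow> tail G e \<rightarrow>\<^bsub>G\<^esub> head G e"
  by (auto simp: arcs_ends_conv)

lemma edge_in_arcs:
  assumes "v \<rightarrow>\<^bsub>G\<^esub> u"
  shows "edge G v u \<in> arcs G" "tail G (edge G v u) = v" "head G (edge G v u) = u"
proof -
  obtain e where "e \<in> arcs G" "tail G e = v" "head G e = u"
    using assms by (auto simp: arcs_ends_def arc_to_ends_def)
  with edge_eq[of e] show "edge G v u \<in> arcs G" "tail G (edge G v u) = v" "head G (edge G v u) = u"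
    by auto
qed

lemma path_spaceD:
  assumes "\<omega> \<in> path_space G"
  shows "\<omega> n \<in> verts G" "edge G (\<omega> n) (\<omega> (Suc n)) \<in> arcs G"
    "tail G (edge G (\<omega> n) (\<omega> (Suc n))) = \<omega> n" "head G (edge G (\<omega> n) (\<omega> (Suc n))) = \<omega> (Suc n)"
  using assms edge_in_arcs[of "\<omega> n" "\<omega> (Suc n)"] by (auto simp: path_space_def)

lemma J_subset_U: "v \<in> verts G \<Longrightarrow> J v \<subseteq> U v"
  using ball_subset_U[of v] \<delta>_pos by fastforce

lemma T_has_derivative:
  assumes "e \<in> arcs G" "x \<in> U (head G e)"
  shows "(T e has_derivative frechet_derivative (T e) (at x)) (at x)"
proof -
  from T_diffeo[OF assms(1)] assms(2) have "T e differentiable (at x)"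
    unfolding C1_diffeo_onto_image_def C1_on_def differentiable_def by blast
  then show ?thesis by (simp add: frechet_derivative_works)
qed

lemma deriv_norm_nonneg:
  assumes "e \<in> arcs G" "x \<in> U (head G e)"
  shows "0 \<le> deriv_norm (T e) x"
  unfolding deriv_norm_def
  by (rule onorm_pos_le[OF has_derivative_bounded_linear[OF T_has_derivative[OF assms]]])

lemma comp_map_in_U:
  assumes "\<omega> \<in> path_space G" "x \<in> U (\<omega> k)"
  shows "comp_map G T \<omega> k x \<in> U (\<omega> 0)"
  using assms
proof (induction k arbitrary: \<omega>)
  case (Suc k)
  have "comp_map G T (shift \<omega>) k x \<in> U (shift \<omega> 0)"
    using Suc by (intro Suc.IH) (auto simp: shift_path_space shift_apply[of _ 0] shift_apply[of _ k])
  then show ?case using T_U[of "edge G (\<omega> 0) (\<omega> 1)"] path_spaceD[OF Suc.prems(1), of 0]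
    by (auto simp: shift_apply[of _ 0] shift_apply[of _ k])
qed simp

lemma comp_map_in_J:
  assumes "\<omega> \<in> path_space G" "x \<in> J (\<omega> k)"
  shows "comp_map G T \<omega> k x \<in> J (\<omega> 0)"
  using assms
proof (induction k arbitrary: \<omega>)
  case (Suc k)
  have "comp_map G T (shift \<omega>) k x \<in> J (shift \<omega> 0)"
    using Suc by (intro Suc.IH) (auto simp: shift_path_space shift_apply[of _ 0] shift_apply[of _ k])
  then show ?case using T_J[of "edge G (\<omega> 0) (\<omega> 1)"] path_spaceD[OF Suc.prems(1), of 0]
    by (auto simp: shift_apply[of _ 0] shift_apply[of _ k])
qed simp

lemma first_edge:
  assumes "\<omega> \<in> path_space G" "x \<in> U (\<omega> (Suc k))"
  shows "edge G (\<omega> 0) (\<omega> 1) \<in> arcs G"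
    and "comp_map G T (shift \<omega>) k x \<in> U (head G (edge G (\<omega> 0) (\<omega> 1)))"
  using path_spaceD[OF assms(1), of 0] comp_map_in_U[of "shift \<omega>" x k] assms
  by (auto simp: shift_path_space shift_apply[of _ 0] shift_apply[of _ k])

lemma norm_prod_nonneg:
  assumes "\<omega> \<in> path_space G" "x \<in> U (\<omega> k)"
  shows "0 \<le> norm_prod G T \<omega> k x"
  using assms
proof (induction k arbitrary: \<omega>)
  case (Suc k)
  have "0 \<le> norm_prod G T (shift \<omega>) k x"
    using Suc by (intro Suc.IH) (auto simp: shift_path_space shift_apply[of _ 0] shift_apply[of _ k])
  then show ?case using deriv_norm_nonneg first_edge[OF Suc.prems] by simp
qed simp

lemma norm_prod_le_power:
  assumes "\<omega> \<in> path_space G" "x \<in> U (\<omega> k)"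
  shows "norm_prod G T \<omega> k x \<le> r ^ k"
  using assms
proof (induction k arbitrary: \<omega>)
  case (Suc k)
  have "norm_prod G T (shift \<omega>) k x \<le> r ^ k" "0 \<le> norm_prod G T (shift \<omega>) k x"
    using Suc norm_prod_nonneg by (auto simp: shift_path_space shift_apply[of _ 0] shift_apply[of _ k])
  then show ?case
    using deriv_norm_nonneg deriv_norm_le_r first_edge[OF Suc.prems] r_bounds
    by (auto intro!: mult_mono)
qed simp

lemma comp_map_has_derivative:
  assumes "\<omega> \<in> path_space G" "x \<in> U (\<omega> k)"
  shows "\<exists>D. (comp_map G T \<omega> k has_derivative D) (at x) \<and> onorm D \<le> norm_prod G T \<omega> k x"
  using assms
proof (induction k arbitrary: \<omega>)
  case 0
  have "comp_map G T \<omega> 0 = (\<lambda>x. x)" by (simp add: fun_eq_iff)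
  then show ?case by (auto intro!: exI[of _ "\<lambda>x. x"] onorm_id_le)
next
  case (Suc k)
  let ?e = "edge G (\<omega> 0) (\<omega> 1)" and ?y = "comp_map G T (shift \<omega>) k x"
  obtain D where D: "(comp_map G T (shift \<omega>) k has_derivative D) (at x)"
      "onorm D \<le> norm_prod G T (shift \<omega>) k x"
    using Suc.IH[of "shift \<omega>"] Suc.prems by (auto simp: shift_path_space shift_apply[of _ 0] shift_apply[of _ k])
  let ?E = "frechet_derivative (T ?e) (at ?y)"
  have E: "(T ?e has_derivative ?E) (at ?y)" using T_has_derivative first_edge[OF Suc.prems] by blast
  have "comp_map G T \<omega> (Suc k) = T ?e \<circ> comp_map G T (shift \<omega>) k" by (simp add: fun_eq_iff)
  then have "(comp_map G T \<omega> (Suc k) has_derivative ?E \<circ> D) (at x)"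
    using diff_chain_at[OF D(1) E] by simp
  moreover have "onorm (?E \<circ> D) \<le> onorm ?E * onorm D"
    using D E by (intro onorm_compose has_derivative_bounded_linear)
  moreover have "\<dots> \<le> norm_prod G T \<omega> (Suc k) x"
    using D(2) deriv_norm_nonneg[OF first_edge[OF Suc.prems]]
    by (simp add: deriv_norm_def mult_left_mono)
  ultimately show ?case by (meson order_trans)
qed

text \<open>The mean value inequality on the convex ball around \<open>p\<close>, which lies in the domain of the maps.\<close>
lemma comp_map_dist_le:
  assumes \<omega>: "\<omega> \<in> path_space G" and p: "p \<in> J (\<omega> k)" and q: "dist p q < \<delta>"
    and K: "\<And>x. x \<in> ball p \<delta> \<Longrightarrow> norm_prod G T \<omega> k x \<le> K"
  shows "dist (comp_map G T \<omega> k p) (comp_map G T \<omega> k q) \<le> K * dist p q"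
proof -
  have "\<exists>D. \<forall>x\<in>ball p \<delta>. (comp_map G T \<omega> k has_derivative D x) (at x) \<and> onorm (D x) \<le> K"
  proof -
    have "x \<in> U (\<omega> k)" if "x \<in> ball p \<delta>" for x
      using ball_subset_U[OF path_spaceD(1)[OF \<omega>] p] that by blast
    then have "\<forall>x\<in>ball p \<delta>. \<exists>D. (comp_map G T \<omega> k has_derivative D) (at x) \<and> onorm D \<le> K"
      using comp_map_has_derivative[OF \<omega>] K by (meson order_trans)
    then show ?thesis by (rule bchoice)
  qed
  then obtain D where D: "\<And>x. x \<in> ball p \<delta> \<Longrightarrow> (comp_map G T \<omega> k has_derivative D x) (at x)"
      "\<And>x. x \<in> ball p \<delta> \<Longrightarrow> onorm (D x) \<le> K" by blast
  have "norm (comp_map G T \<omega> k p - comp_map G T \<omega> k q) \<le> K * norm (p - q)"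
    by (rule differentiable_bound[OF convex_ball, of p \<delta> _ D])
       (use D q \<delta>_pos in \<open>auto intro: has_derivative_at_withinI\<close>)
  then show ?thesis by (simp add: dist_norm)
qed

lemma comp_map_dist_le_diameter:
  assumes \<omega>: "\<omega> \<in> path_space G"
    and K: "\<And>p x. \<lbrakk>p \<in> J (\<omega> k); x \<in> ball p \<delta>\<rbrakk> \<Longrightarrow> norm_prod G T \<omega> k x \<le> K"
    and xy: "x \<in> J (\<omega> k)" "y \<in> J (\<omega> k)"
  shows "dist (comp_map G T \<omega> k x) (comp_map G T \<omega> k y) \<le> K * (M * diameter (J (\<omega> k)))"
proof (rule M_bound[where f = "comp_map G T \<omega> k"])
  show "\<omega> k \<in> verts G" using \<omega> by (rule path_spaceD)
  have "x \<in> U (\<omega> k)" using xy J_subset_U path_spaceD(1)[OF \<omega>] by blast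
  then show "0 \<le> K" using norm_prod_nonneg[OF \<omega>] K[OF xy(1)] \<delta>_pos
    by (meson centre_in_ball order_trans)
  fix p q assume p: "p \<in> J (\<omega> k)" and q: "dist p q < \<delta>"
  show "dist (comp_map G T \<omega> k p) (comp_map G T \<omega> k q) \<le> K * dist p q"
    by (rule comp_map_dist_le[OF \<omega> p q K[OF p]])
qed (fact xy)+

text \<open>
  The scale of the starting configuration in \<open>comp_map_contracting\<close>: \<open>\<delta>\<close> accounts for a step into
  \<open>J v\<close> from nearby, and \<open>M * B\<close> for moving within \<open>J v\<close>.
\<close>
definition L :: real where "L = \<delta> + M * B"

text \<open>
  The point \<open>x\<close> may leave \<open>J\<close>: the mean value inequality needs the derivative on whole balls around
  points of \<open>J\<close>, so distortion has to be controlled there as well. The two steps from \<open>x\<close> to \<open>p\<close> and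
  from \<open>p\<close> to \<open>y\<close> are estimated separately.
\<close>
lemma comp_map_contracting:
  assumes \<omega>: "\<omega> \<in> path_space G" and p: "p \<in> J (\<omega> k)" and x: "x \<in> ball p \<delta>" and y: "y \<in> J (\<omega> k)"
  shows "dist (comp_map G T \<omega> k x) (comp_map G T \<omega> k y) \<le> r ^ k * L"
proof -
  have v: "\<omega> k \<in> verts G" using \<omega> by (rule path_spaceD)
  have N: "norm_prod G T \<omega> k z \<le> r ^ k" if "p \<in> J (\<omega> k)" "z \<in> ball p \<delta>" for z p
    using norm_prod_le_power[OF \<omega>] ball_subset_U[OF v] that by blast
  have "dist (comp_map G T \<omega> k p) (comp_map G T \<omega> k x) \<le> r ^ k * dist p x"
    using x p N by (intro comp_map_dist_le[OF \<omega>]) auto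
  also have "\<dots> \<le> r ^ k * \<delta>" using x r_bounds by (intro mult_left_mono) auto
  finally have 1: "dist (comp_map G T \<omega> k p) (comp_map G T \<omega> k x) \<le> r ^ k * \<delta>" .
  have "dist (comp_map G T \<omega> k p) (comp_map G T \<omega> k y) \<le> r ^ k * (M * diameter (J (\<omega> k)))"
    using N p y by (intro comp_map_dist_le_diameter[OF \<omega>])
  also have "\<dots> \<le> r ^ k * (M * B)"
    using r_bounds M_pos diameter_le_B[OF v] by (intro mult_left_mono) auto
  finally have "dist (comp_map G T \<omega> k p) (comp_map G T \<omega> k y) \<le> r ^ k * (M * B)" .
  with 1 have "dist (comp_map G T \<omega> k x) (comp_map G T \<omega> k y) \<le> r ^ k * \<delta> + r ^ k * (M * B)"
    by (smt (verit) dist_commute dist_triangle)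
  then show ?thesis by (simp add: L_def distrib_left)
qed

subsection \<open>The coding map\<close>

text \<open>
  The sets are compact and decreasing, so they have a common point, and their diameters tend to \<open>0\<close>.
  This makes the definite description in \<^const>\<open>coding\<close> meaningful.
\<close>
lemma coding_singleton:
  assumes \<omega>: "\<omega> \<in> path_space G"
  shows "(\<Inter>k. path_map G T \<omega> k ` J (\<omega> (Suc k))) = {coding G J T \<omega>}"
proof -
  let ?F = "\<lambda>k. path_map G T \<omega> k ` J (\<omega> (Suc k))"
  have cpt: "compact (?F k)" for k
  proof (rule compact_continuous_image)
    have v: "\<omega> (Suc k) \<in> verts G" using \<omega> by (rule path_spaceD)
    show "compact (J (\<omega> (Suc k)))" using v by (rule J_compact)
    have "\<exists>D. (path_map G T \<omega> k has_derivative D) (at x within J (\<omega> (Suc k)))"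
      if "x \<in> J (\<omega> (Suc k))" for x
      using comp_map_has_derivative[OF \<omega>, of x "Suc k"] J_subset_U[OF v] that
      unfolding path_map_eq_comp_map by (meson has_derivative_at_withinI subsetD)
    then show "continuous_on (J (\<omega> (Suc k))) (path_map G T \<omega> k)"
      by (meson continuous_on_eq_continuous_within has_derivative_continuous)
  qed
  have ne: "?F k \<noteq> {}" for k using J_nonempty path_spaceD(1)[OF \<omega>] by simp
  have step: "?F (Suc k) \<subseteq> ?F k" for k
    using T_J[of "edge G (\<omega> (Suc k)) (\<omega> (Suc (Suc k)))"] path_spaceD[OF \<omega>, of "Suc k"] by auto
  have dec: "?F n \<subseteq> ?F m" if "m \<le> n" for m n
    by (rule lift_Suc_antimono_le[of ?F, OF step that])
  have "\<Inter>(range ?F) \<noteq> {}" by (rule compact_nest[OF cpt ne dec])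
  then obtain x where x: "x \<in> (\<Inter>k. ?F k)" by blast
  have "y = x" if y: "y \<in> (\<Inter>k. ?F k)" for y
  proof -
    have "dist y x \<le> r ^ Suc k * L" for k
    proof -
      from x y obtain x' y' where "x' \<in> J (\<omega> (Suc k))" "y' \<in> J (\<omega> (Suc k))"
        "x = comp_map G T \<omega> (Suc k) x'" "y = comp_map G T \<omega> (Suc k) y'"
        unfolding path_map_eq_comp_map by blast
      then show ?thesis using comp_map_contracting[OF \<omega>, of y' "Suc k" y' x'] \<delta>_pos
        by (simp del: comp_map.simps power_Suc)
    qed
    moreover have "(\<lambda>k. r ^ Suc k * L) \<longlonglongrightarrow> 0 * L"
      using r_bounds by (intro tendsto_mult tendsto_const LIMSEQ_Suc LIMSEQ_realpow_zero) auto
    ultimately have "dist y x \<le> 0 * L" by (intro LIMSEQ_le_const) auto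
    then show ?thesis by simp
  qed
  with x have "(\<Inter>k. ?F k) = {x}" by blast
  then show ?thesis unfolding coding_def by simp
qed

lemma coding_in_J:
  assumes "\<omega> \<in> path_space G" shows "coding G J T \<omega> \<in> J (\<omega> 0)"
proof -
  have "coding G J T \<omega> \<in> path_map G T \<omega> 0 ` J (\<omega> (Suc 0))" using coding_singleton[OF assms] by blast
  then show ?thesis using comp_map_in_J[OF assms, of _ 1]
    by (auto simp: path_map_eq_comp_map simp del: comp_map.simps)
qed

lemma coding_in_U:
  assumes "\<omega> \<in> path_space G" shows "coding G J T \<omega> \<in> U (\<omega> 0)"
  using coding_in_J[OF assms] J_subset_U path_spaceD(1)[OF assms] by blast

lemma coding_shift:
  assumes "\<omega> \<in> path_space G"
  shows "coding G J T \<omega> = T (edge G (\<omega> 0) (\<omega> 1)) (coding G J T (shift \<omega>))"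
proof -
  let ?x = "coding G J T (shift \<omega>)"
  have sh: "shift \<omega> \<in> path_space G" using assms by (rule shift_path_space)
  have "T (edge G (\<omega> 0) (\<omega> 1)) ?x \<in> path_map G T \<omega> k ` J (\<omega> (Suc k))" for k
  proof (cases k)
    case 0
    then show ?thesis using coding_in_J[OF sh] by (auto simp: shift_apply[of _ 0] shift_apply[of _ k])
  next
    case (Suc m)
    have "?x \<in> path_map G T (shift \<omega>) m ` J (shift \<omega> (Suc m))"
      using coding_singleton[OF sh] by blast
    then show ?thesis unfolding Suc path_map_Suc by (auto simp: shift_apply[of _ "Suc m"])
  qed
  then have "T (edge G (\<omega> 0) (\<omega> 1)) ?x \<in> (\<Inter>k. path_map G T \<omega> k ` J (\<omega> (Suc k)))" by blast
  then show ?thesis unfolding coding_singleton[OF assms] by simp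
qed

lemma coding_eq_comp_map:
  "\<omega> \<in> path_space G \<Longrightarrow> coding G J T \<omega> = comp_map G T \<omega> k (coding G J T ((shift ^^ k) \<omega>))"
proof (induction k arbitrary: \<omega>)
  case (Suc k)
  have "coding G J T (shift \<omega>) = comp_map G T (shift \<omega>) k (coding G J T ((shift ^^ k) (shift \<omega>)))"
    using Suc by (intro Suc.IH shift_path_space)
  then show ?case using coding_shift[OF Suc.prems] by (simp add: funpow_swap1)
qed simp

text \<open>
  At a coded point the orbit consists of the coded points of the shifted paths, so the factors of
  \<^const>\<open>norm_prod\<close> are those that the potential records. Only the inequality \<open>t \<le> exp (ln t)\<close> for
  \<open>t \<ge> 0\<close> is used, which holds for \<open>t = 0\<close> too because \<open>ln 0 = 0\<close> for the total logarithm.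
\<close>
lemma norm_prod_coding_le_exp_birkhoff:
  "\<omega> \<in> path_space G \<Longrightarrow>
    norm_prod G T \<omega> k (coding G J T ((shift ^^ k) \<omega>)) \<le> exp (birkhoff_sum (potential G J T) k \<omega>)"
proof (induction k arbitrary: \<omega>)
  case 0
  then show ?case by (simp add: birkhoff_sum_def)
next
  case (Suc k)
  let ?z = "coding G J T ((shift ^^ Suc k) \<omega>)"
  have sh: "shift \<omega> \<in> path_space G" using Suc.prems by (rule shift_path_space)
  have z: "?z \<in> U (\<omega> (Suc k))"
    using coding_in_U[OF funpow_shift_path_space[OF Suc.prems, of "Suc k"]] funpow_shift[of "Suc k" \<omega> 0]
    by (simp only: add_0_right)
  have "norm_prod G T (shift \<omega>) k ?z \<le> exp (birkhoff_sum (potential G J T) k (shift \<omega>))"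
    using Suc.IH[OF sh] by (simp add: funpow_swap1)
  moreover have "deriv_norm (T (edge G (\<omega> 0) (\<omega> 1))) (comp_map G T (shift \<omega>) k ?z)
      \<le> exp (potential G J T \<omega>)"
  proof -
    have "comp_map G T (shift \<omega>) k ?z = coding G J T (shift \<omega>)"
      using coding_eq_comp_map[OF sh, of k] by (simp add: funpow_swap1)
    moreover have "t \<le> exp (ln t)" if "0 \<le> t" for t :: real
      using that by (cases "t = 0") auto
    ultimately show ?thesis
      using deriv_norm_nonneg[OF first_edge[OF Suc.prems z]] by (simp add: potential_def)
  qed
  moreover have "birkhoff_sum (potential G J T) (Suc k) \<omega> =
      potential G J T \<omega> + birkhoff_sum (potential G J T) k (shift \<omega>)"
    unfolding birkhoff_sum_def by (subst sum.lessThan_Suc_shift) (simp add: funpow_swap1)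
  moreover have "0 \<le> norm_prod G T (shift \<omega>) k ?z"
    using norm_prod_nonneg[OF sh] z by (simp add: shift_apply[of _ 0] shift_apply[of _ k])
  ultimately show ?case
    by (simp only: norm_prod.simps exp_add) (intro mult_mono; simp)
qed

subsection \<open>Bounded distortion of compositions\<close>

lemma L_nonneg: "0 \<le> L"
  using \<delta>_pos M_pos B_nonneg by (simp add: L_def)

lemma deriv_norm_distortion:
  assumes "e \<in> arcs G" "x \<in> U (head G e)" "y \<in> U (head G e)" "dist x y \<le> d"
  shows "deriv_norm (T e) x \<le> (1 + c1 * d powr \<beta>) * deriv_norm (T e) y"
proof -
  have "\<bar>deriv_norm (T e) y - deriv_norm (T e) x\<bar> \<le> c1 * deriv_norm (T e) y * norm (y - x) powr \<beta>"
    using assms by (intro distortion)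
  also have "\<dots> \<le> c1 * deriv_norm (T e) y * d powr \<beta>"
    using assms deriv_norm_nonneg distortion_bounds
    by (intro mult_left_mono powr_mono2) (auto simp: dist_norm norm_minus_commute)
  finally show ?thesis by (simp add: algebra_simps)
qed

text \<open>
  After \<open>k\<close> maps the two orbits are within \<open>r ^ k * L\<close>, so the next factor is distorted by at most
  \<open>1 + c1 * (r ^ k * L) powr \<beta>\<close>, that is \<open>1\<close> plus a term of a geometric sequence of ratio \<open>r powr \<beta>\<close>.
\<close>
lemma norm_prod_distortion:
  assumes "\<omega> \<in> path_space G" "p \<in> J (\<omega> k)" "x \<in> ball p \<delta>" "y \<in> J (\<omega> k)"
  shows "norm_prod G T \<omega> k x \<le>
    (\<Prod>i<k. 1 + (c1 * L powr \<beta>) * (r powr \<beta>) ^ i) * norm_prod G T \<omega> k y"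
  using assms
proof (induction k arbitrary: \<omega>)
  case (Suc k)
  let ?e = "edge G (\<omega> 0) (\<omega> 1)" and ?f = "comp_map G T (shift \<omega>) k"
  let ?N = "norm_prod G T (shift \<omega>) k" and ?a = "c1 * L powr \<beta>"
  let ?P = "\<Prod>i<k. 1 + ?a * (r powr \<beta>) ^ i"
  have sh: "shift \<omega> \<in> path_space G" using Suc.prems(1) by (rule shift_path_space)
  have v: "\<omega> (Suc k) \<in> verts G" by (rule path_spaceD) fact
  have x: "x \<in> U (\<omega> (Suc k))" and y: "y \<in> U (\<omega> (Suc k))"
    using ball_subset_U[OF v Suc.prems(2)] J_subset_U[OF v] Suc.prems by auto
  note L = L_nonneg
  have "dist (?f x) (?f y) \<le> r ^ k * L"
    using Suc.prems by (intro comp_map_contracting[OF sh, of p]) (auto simp: shift_apply[of _ 0] shift_apply[of _ k])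
  then have "deriv_norm (T ?e) (?f x) \<le> (1 + c1 * (r ^ k * L) powr \<beta>) * deriv_norm (T ?e) (?f y)"
    using first_edge[OF Suc.prems(1) x] first_edge[OF Suc.prems(1) y] by (intro deriv_norm_distortion)
  moreover have "(r ^ k * L) powr \<beta> = L powr \<beta> * (r powr \<beta>) ^ k"
    using L r_bounds by (simp add: powr_mult powr_power powr_realpow[symmetric] powr_powr mult.commute)
  ultimately have d: "deriv_norm (T ?e) (?f x) \<le> (1 + ?a * (r powr \<beta>) ^ k) * deriv_norm (T ?e) (?f y)"
    by (simp add: mult.assoc)
  have n: "?N x \<le> ?P * ?N y"
    by (rule Suc.IH[OF sh]) (use Suc.prems in \<open>auto simp: shift_apply[of _ 0] shift_apply[of _ k]\<close>)
  have "norm_prod G T \<omega> (Suc k) x \<le>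
      ((1 + ?a * (r powr \<beta>) ^ k) * deriv_norm (T ?e) (?f y)) * (?P * ?N y)"
    unfolding norm_prod.simps
    using d n norm_prod_nonneg[OF sh, of x k] deriv_norm_nonneg first_edge[OF Suc.prems(1) y]
      distortion_bounds x
    by (intro mult_mono) (auto simp: shift_apply[of _ 0] shift_apply[of _ k] intro!: mult_nonneg_nonneg add_nonneg_nonneg)
  then show ?case by (simp add: mult_ac)
qed simp

definition distortion_constant :: real where
  "distortion_constant = exp (c1 * L powr \<beta> / (1 - r powr \<beta>))"

lemma norm_prod_distortion_uniform:
  assumes \<omega>: "\<omega> \<in> path_space G" and p: "p \<in> J (\<omega> k)" and x: "x \<in> ball p \<delta>" and y: "y \<in> J (\<omega> k)"
  shows "norm_prod G T \<omega> k x \<le> distortion_constant * norm_prod G T \<omega> k y"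
proof -
  have "y \<in> U (\<omega> k)" using y J_subset_U path_spaceD(1)[OF \<omega>] by blast
  then have n: "0 \<le> norm_prod G T \<omega> k y" by (rule norm_prod_nonneg[OF \<omega>])
  have "r powr \<beta> < 1" using r_bounds distortion_bounds
    by (metis less_eq_real_def powr_less_mono2 powr_one_eq_one)
  then have "(\<Prod>i<k. 1 + (c1 * L powr \<beta>) * (r powr \<beta>) ^ i) \<le> distortion_constant"
    unfolding distortion_constant_def using distortion_bounds by (intro prod_one_plus_geometric_le) auto
  from mult_right_mono[OF this n] norm_prod_distortion[OF assms] show ?thesis by linarith
qed

subsection \<open>Existence of good continuations\<close>

text \<open>A nonempty set that is the closure of its interior contains a ball.\<close>
lemma diameter_J_pos:
  assumes "v \<in> verts G" shows "0 < diameter (J v)"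
proof -
  have "interior (J v) \<noteq> {}" using J_regular[OF assms] J_nonempty[OF assms] by force
  then obtain x e where e: "0 < e" "ball x e \<subseteq> J v" by (auto simp: mem_interior)
  have "0 < diameter (ball x e)" using e by (simp add: diameter_ball)
  also have "\<dots> \<le> diameter (J v)"
    using e J_compact[OF assms] by (intro diameter_subset compact_imp_bounded)
  finally show ?thesis .
qed

text \<open>
  The supremum in the contractibility condition need not be attained, but a positive supremum exceeds
  half of itself somewhere; this is the origin of the factor \<open>2\<close>. An empty supremum would be \<open>0\<close>, so
  positivity of the diameter also yields that the vertex has an outgoing edge.
\<close>
lemma successor_comparable:
  assumes v: "v \<in> verts G"
  shows "\<exists>e\<in>arcs G. tail G e = v \<and> (\<exists>z\<in>J (head G e). diameter (J v) \<le> 2 * c2 * deriv_norm (T e) z)"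
proof (rule ccontr)
  assume neg: "\<not> ?thesis"
  have d: "0 < diameter (J v)" by (rule diameter_J_pos[OF v])
  let ?S = "SUP e\<in>{e \<in> arcs G. tail G e = v}. SUP z\<in>J (head G e). ennreal (deriv_norm (T e) z)"
  have "?S \<le> ennreal (diameter (J v) / (2 * c2))"
  proof (intro SUP_least ennreal_leI)
    fix e z assume "e \<in> {e \<in> arcs G. tail G e = v}" "z \<in> J (head G e)"
    then show "deriv_norm (T e) z \<le> diameter (J v) / (2 * c2)"
      using neg c2_pos by (force simp: field_simps)
  qed
  then have "ennreal c2 * ?S \<le> ennreal c2 * ennreal (diameter (J v) / (2 * c2))"
    by (rule mult_left_mono) simp
  also have "\<dots> = ennreal (diameter (J v) / 2)"
    using c2_pos d by (simp add: ennreal_mult[symmetric])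
  finally have "ennreal (diameter (J v)) \<le> ennreal (diameter (J v) / 2)"
    using contractible[OF v] by (rule order_trans[rotated])
  then show False using d by simp
qed

text \<open>There are no dead ends: a path is built by following a chosen outgoing edge at each vertex.\<close>
lemma path_extension:
  assumes "u \<in> verts G"
  obtains \<eta> where "\<eta> \<in> path_space G" "\<eta> 0 = u"
proof -
  have "\<forall>v\<in>verts G. \<exists>w. v \<rightarrow>\<^bsub>G\<^esub> w"
    using successor_comparable by (metis dominates_arc)
  then obtain nxt where nxt: "\<And>v. v \<in> verts G \<Longrightarrow> v \<rightarrow>\<^bsub>G\<^esub> nxt v" by metis
  have v: "(nxt ^^ i) u \<in> verts G" for i
    by (induction i) (simp_all add: assms adj_in_verts(2)[OF nxt])
  then have "(\<lambda>i. (nxt ^^ i) u) \<in> path_space G" by (simp add: path_space_def nxt)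
  then show ?thesis by (rule that) simp
qed

lemma cylinderD:
  assumes "\<omega> \<in> cylinder G w"
  shows "\<omega> \<in> path_space G" "\<And>i. i < length w \<Longrightarrow> \<omega> i = w ! i"
proof -
  show "\<omega> \<in> path_space G" using assms by (simp add: cylinder_def)
  fix i assume i: "i < length w"
  have "map \<omega> [0..<length w] = w" using assms by (simp add: cylinder_def)
  from arg_cong[OF this, of "\<lambda>v. v ! i"] i show "\<omega> i = w ! i" by simp
qed

text \<open>
  Keep the first \<open>k + 1\<close> vertices of \<open>\<omega>\<close>, leave the last of them through the edge given by
  \<open>successor_comparable\<close>, and continue arbitrarily. That edge has a large derivative at some point of
  the next set \<open>J\<close>; by distortion it is comparable with the derivative at the point coded by the
  continuation, which is the one that enters the potential.
\<close>
lemma good_continuation: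
  assumes w: "\<omega> \<in> cylinder G w" "length w = Suc k"
  obtains \<omega>' where "\<omega>' \<in> cylinder G w"
    "diameter (J (\<omega> k)) \<le> 2 * c2 * (1 + c1 * B powr \<beta>) * exp (potential G J T ((shift ^^ k) \<omega>'))"
proof -
  have \<omega>: "\<omega> \<in> path_space G" using w(1) by (rule cylinderD)
  have v: "\<omega> k \<in> verts G" using \<omega> by (rule path_spaceD)
  obtain e z where e: "e \<in> arcs G" "tail G e = \<omega> k" and z: "z \<in> J (head G e)"
    and dz: "diameter (J (\<omega> k)) \<le> 2 * c2 * deriv_norm (T e) z"
    using successor_comparable[OF v] by blast
  let ?u = "head G e"
  have u: "?u \<in> verts G" using e by simp
  obtain \<eta> where \<eta>: "\<eta> \<in> path_space G" "\<eta> 0 = ?u" using path_extension[OF u] by blast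
  define \<omega>' where "\<omega>' i = (if i \<le> k then \<omega> i else \<eta> (i - Suc k))" for i
  have "\<omega>' i \<in> verts G \<and> \<omega>' i \<rightarrow>\<^bsub>G\<^esub> \<omega>' (Suc i)" for i
  proof -
    consider "i < k" | "i = k" | "k < i" by linarith
    then show ?thesis
    proof cases
      case 1 then show ?thesis using \<omega> by (auto simp: \<omega>'_def path_space_def)
    next
      case 2 then show ?thesis using v e \<eta>(2) dominates_arc[of e]
        by (simp add: \<omega>'_def)
    next
      case 3
      then have "Suc i - Suc k = Suc (i - Suc k)" by simp
      with 3 show ?thesis using \<eta>(1) by (simp add: \<omega>'_def path_space_def del: diff_Suc_Suc)
    qed
  qed
  then have p: "\<omega>' \<in> path_space G" by (simp add: path_space_def)
  have "map \<omega>' [0..<length w] = map \<omega> [0..<length w]" using w(2) by (auto simp: \<omega>'_def)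
  with p w(1) have c: "\<omega>' \<in> cylinder G w" by (simp add: cylinder_def)
  have sh: "shift ((shift ^^ k) \<omega>') = \<eta>"
    using funpow_shift[of "Suc k" \<omega>'] by (auto simp: \<omega>'_def)
  let ?y = "coding G J T \<eta>"
  have y: "?y \<in> J ?u" using coding_in_J[OF \<eta>(1)] \<eta>(2) by simp
  have ed: "edge G ((shift ^^ k) \<omega>' 0) ((shift ^^ k) \<omega>' 1) = e"
    using e \<eta>(2) edge_eq[of e] by (simp add: funpow_shift \<omega>'_def)
  have "deriv_norm (T e) z \<le> (1 + c1 * B powr \<beta>) * deriv_norm (T e) ?y"
  proof (rule deriv_norm_distortion)
    show "dist z ?y \<le> B"
      using diameter_bounded_bound[OF compact_imp_bounded[OF J_compact[OF u]] z y]
        diameter_le_B[OF u] by simp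
  qed (use e z y J_subset_U[OF u] in auto)
  also have "\<dots> \<le> (1 + c1 * B powr \<beta>) * exp (potential G J T ((shift ^^ k) \<omega>'))"
  proof (rule mult_left_mono)
    have "0 \<le> deriv_norm (T e) ?y" using e y J_subset_U[OF u] by (intro deriv_norm_nonneg) auto
    then show "deriv_norm (T e) ?y \<le> exp (potential G J T ((shift ^^ k) \<omega>'))"
      unfolding potential_def sh ed by (cases "deriv_norm (T e) ?y = 0") auto
  qed (use distortion_bounds in auto)
  finally have "2 * c2 * deriv_norm (T e) z \<le>
      2 * c2 * ((1 + c1 * B powr \<beta>) * exp (potential G J T ((shift ^^ k) \<omega>')))"
    using c2_pos by (intro mult_left_mono) auto
  with dz c show ?thesis by (intro that[of \<omega>']) (auto simp: mult.assoc)
qed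

subsection \<open>Size of the cylinder images\<close>

text \<open>
  All paths in the cylinder share their first \<open>k\<close> edges, hence their coded points are images under one
  composition of points of \<open>J (\<omega> k)\<close>. Distortion lets any \<open>\<omega>\<close> of the cylinder serve as reference.
\<close>
lemma dist_coding_cylinder_le:
  assumes w: "length w = Suc k" and c: "\<omega> \<in> cylinder G w" "\<omega>1 \<in> cylinder G w" "\<omega>2 \<in> cylinder G w"
  shows "dist (coding G J T \<omega>1) (coding G J T \<omega>2) \<le>
    distortion_constant * norm_prod G T \<omega> k (coding G J T ((shift ^^ k) \<omega>)) * (M * diameter (J (\<omega> k)))"
    and "dist (coding G J T \<omega>1) (coding G J T \<omega>2) \<le> r ^ k * L"
proof -
  have \<omega>: "\<omega> \<in> path_space G" using c(1) by (rule cylinderD)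
  have *: "coding G J T \<omega>' = comp_map G T \<omega> k (coding G J T ((shift ^^ k) \<omega>')) \<and>
      coding G J T ((shift ^^ k) \<omega>') \<in> J (\<omega> k)" if c': "\<omega>' \<in> cylinder G w" for \<omega>'
  proof -
    have \<omega>': "\<omega>' \<in> path_space G" using c' by (rule cylinderD)
    have eq: "\<omega>' i = \<omega> i" if "i \<le> k" for i using cylinderD(2)[OF c(1), of i] cylinderD(2)[OF c', of i] w that by simp
    have "coding G J T \<omega>' = comp_map G T \<omega> k (coding G J T ((shift ^^ k) \<omega>'))"
      using coding_eq_comp_map[OF \<omega>'] comp_map_cong[OF eq] by (rule trans)
    moreover have "coding G J T ((shift ^^ k) \<omega>') \<in> J (\<omega> k)"
      using coding_in_J[OF funpow_shift_path_space[OF \<omega>', of k]]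
      unfolding funpow_shift[of k \<omega>' 0] by (simp only: add_0_right eq[OF order_refl])
    ultimately show ?thesis by (rule conjI)
  qed
  let ?x = "\<lambda>\<omega>'. coding G J T ((shift ^^ k) \<omega>')"
  have "dist (comp_map G T \<omega> k (?x \<omega>1)) (comp_map G T \<omega> k (?x \<omega>2)) \<le>
     distortion_constant * norm_prod G T \<omega> k (?x \<omega>) * (M * diameter (J (\<omega> k)))"
  proof (rule comp_map_dist_le_diameter[OF \<omega>])
    fix p x assume "p \<in> J (\<omega> k)" "x \<in> ball p \<delta>"
    then show "norm_prod G T \<omega> k x \<le> distortion_constant * norm_prod G T \<omega> k (?x \<omega>)"
      using *[OF c(1)] by (intro norm_prod_distortion_uniform[OF \<omega>]) auto
  qed (use *[OF c(2)] *[OF c(3)] in blast)+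
  then show "dist (coding G J T \<omega>1) (coding G J T \<omega>2) \<le>
    distortion_constant * norm_prod G T \<omega> k (?x \<omega>) * (M * diameter (J (\<omega> k)))"
    unfolding conjunct1[OF *[OF c(2)]] conjunct1[OF *[OF c(3)]] .
  have "dist (comp_map G T \<omega> k (?x \<omega>1)) (comp_map G T \<omega> k (?x \<omega>2)) \<le> r ^ k * L"
    by (rule comp_map_contracting[OF \<omega>, of "?x \<omega>1"])
       (use *[OF c(2)] *[OF c(3)] \<delta>_pos in \<open>simp_all only: centre_in_ball\<close>)
  then show "dist (coding G J T \<omega>1) (coding G J T \<omega>2) \<le> r ^ k * L"
    unfolding conjunct1[OF *[OF c(2)]] conjunct1[OF *[OF c(3)]] .
qed

text \<open>
  The constant is the product of the three losses: distortion along the word, non-convexity of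
  \<open>J v\<close>, and the comparison of \<open>diameter (J v)\<close> with a derivative.
\<close>
definition C :: real where "C = distortion_constant * M * (2 * c2 * (1 + c1 * B powr \<beta>))"

lemma C_pos: "0 < C"
  using M_pos c2_pos distortion_bounds
  by (auto simp: C_def distortion_constant_def intro!: mult_pos_pos add_pos_nonneg)

text \<open>
  The last estimate involves \<open>Suc k\<close> terms of the potential although only \<open>k\<close> maps are composed: the
  additional term comes from \<open>diameter (J v)\<close> through \<open>good_continuation\<close>, and this is why \<open>\<omega>\<close> cannot
  be chosen freely.
\<close>
lemma diameter_coding_cylinder:
  assumes w: "length w = Suc k" "cylinder G w \<noteq> {}"
  shows "bounded (coding G J T ` cylinder G w)"
    and "diameter (coding G J T ` cylinder G w) \<le> r ^ k * L"
    and "\<exists>\<omega>\<in>cylinder G w. diameter (coding G J T ` cylinder G w) \<le>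
           C * exp (birkhoff_sum (potential G J T) (Suc k) \<omega>)"
proof -
  obtain \<omega>0 where \<omega>0: "\<omega>0 \<in> cylinder G w" using w by blast
  have d: "dist x y \<le> r ^ k * L"
    if "x \<in> coding G J T ` cylinder G w" "y \<in> coding G J T ` cylinder G w" for x y
    using that by (elim imageE) (simp only: dist_coding_cylinder_le(2)[OF w(1) \<omega>0])
  then show "bounded (coding G J T ` cylinder G w)"
    unfolding bounded_two_points by blast
  show "diameter (coding G J T ` cylinder G w) \<le> r ^ k * L"
    using d w(2) by (intro diameter_le) (auto simp: dist_norm)
  obtain \<omega> where \<omega>: "\<omega> \<in> cylinder G w" and dJ: "diameter (J (\<omega>0 k)) \<le>
      2 * c2 * (1 + c1 * B powr \<beta>) * exp (potential G J T ((shift ^^ k) \<omega>))"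
    using good_continuation[OF \<omega>0 w(1)] by blast
  have \<omega>p: "\<omega> \<in> path_space G" using \<omega> by (rule cylinderD)
  have eq: "\<omega> k = \<omega>0 k" using cylinderD(2)[OF \<omega>, of k] cylinderD(2)[OF \<omega>0, of k] w(1) by simp
  let ?n = "norm_prod G T \<omega> k (coding G J T ((shift ^^ k) \<omega>))"
  have n0: "0 \<le> ?n"
    using coding_in_U[OF funpow_shift_path_space[OF \<omega>p, of k]] norm_prod_nonneg[OF \<omega>p]
    by (simp add: funpow_shift)
  have n: "?n \<le> exp (birkhoff_sum (potential G J T) k \<omega>)"
    using \<omega>p by (rule norm_prod_coding_le_exp_birkhoff)
  have J0: "0 < diameter (J (\<omega> k))" using diameter_J_pos path_spaceD(1)[OF \<omega>p] by simp
  have "distortion_constant * ?n * (M * diameter (J (\<omega> k))) \<le>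
     distortion_constant * exp (birkhoff_sum (potential G J T) k \<omega>) *
       (M * (2 * c2 * (1 + c1 * B powr \<beta>) * exp (potential G J T ((shift ^^ k) \<omega>))))"
    using n dJ n0 M_pos J0 unfolding eq distortion_constant_def
    by (intro mult_mono mult_left_mono) auto
  also have "\<dots> = C * exp (birkhoff_sum (potential G J T) (Suc k) \<omega>)"
    by (simp add: C_def birkhoff_sum_def exp_add mult_ac)
  finally have "norm (x - y) \<le> C * exp (birkhoff_sum (potential G J T) (Suc k) \<omega>)"
    if "x \<in> coding G J T ` cylinder G w" "y \<in> coding G J T ` cylinder G w" for x y
    using that
    by (elim imageE)
       (simp only: dist_norm[symmetric], rule order_trans[OF dist_coding_cylinder_le(1)[OF w(1) \<omega>]])
  then have "diameter (coding G J T ` cylinder G w) \<le> C * exp (birkhoff_sum (potential G J T) (Suc k) \<omega>)"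
    using w(2) by (intro diameter_le) auto
  then show "\<exists>\<omega>\<in>cylinder G w. diameter (coding G J T ` cylinder G w) \<le>
           C * exp (birkhoff_sum (potential G J T) (Suc k) \<omega>)" using \<omega> by blast
qed

subsection \<open>Vanishing of the Hausdorff measure\<close>

lemma countable_admissible_words: "countable (admissible_words G n)"
proof (rule countable_subset)
  show "admissible_words G n \<subseteq> lists (verts G)" by (auto simp: admissible_words_def)
  show "countable (lists (verts G))" using countable_verts by simp
qed

lemma limit_set_cover:
  "limit_set G J T \<subseteq> (\<Union>w\<in>admissible_words G n. coding G J T ` cylinder G w)"
proof
  fix x assume "x \<in> limit_set G J T"
  then obtain \<omega> where \<omega>: "\<omega> \<in> path_space G" and x: "x = coding G J T \<omega>"
    by (auto simp: limit_set_def)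
  have c: "\<omega> \<in> cylinder G (map \<omega> [0..<n])" using \<omega> by (simp add: cylinder_def)
  then have "map \<omega> [0..<n] \<in> admissible_words G n"
    using path_spaceD(1)[OF \<omega>] by (auto simp: admissible_words_def)
  with c x show "x \<in> (\<Union>w\<in>admissible_words G n. coding G J T ` cylinder G w)" by blast
qed

lemma diam_power_coding_cylinder:
  assumes s: "0 \<le> s" "s < s'" and w: "length w = Suc k" "cylinder G w \<noteq> {}"
  shows "diam_power s' (coding G J T ` cylinder G w) \<le>
    ennreal (C powr s * (r ^ k * L) powr (s' - s)) *
      (SUP \<omega>\<in>cylinder G w. ennreal (exp (birkhoff_sum (\<lambda>\<omega>. s * potential G J T \<omega>) (Suc k) \<omega>)))"
proof -
  let ?d = "diameter (coding G J T ` cylinder G w)"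
  obtain \<omega> where \<omega>: "\<omega> \<in> cylinder G w"
    and dC: "?d \<le> C * exp (birkhoff_sum (potential G J T) (Suc k) \<omega>)"
    using diameter_coding_cylinder(3)[OF w] by blast
  let ?S = "birkhoff_sum (potential G J T) (Suc k) \<omega>"
  have d0: "0 \<le> ?d" by (rule diameter_ge_0[OF diameter_coding_cylinder(1)[OF w]])
  have "?d powr s' = ?d powr s * ?d powr (s' - s)" by (simp add: powr_add[symmetric])
  also have "\<dots> \<le> (C * exp ?S) powr s * (r ^ k * L) powr (s' - s)"
    using s d0 dC diameter_coding_cylinder(2)[OF w] by (intro mult_mono powr_mono2) auto
  also have "(C * exp ?S) powr s = C powr s * exp (s * ?S)"
    using C_pos by (simp add: powr_mult exp_powr_real mult.commute)
  also have "s * ?S = birkhoff_sum (\<lambda>\<omega>. s * potential G J T \<omega>) (Suc k) \<omega>"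
    unfolding birkhoff_sum_def by (rule sum_distrib_left)
  finally have "ennreal (?d powr s') \<le> ennreal (C powr s * (r ^ k * L) powr (s' - s)) *
      ennreal (exp (birkhoff_sum (\<lambda>\<omega>. s * potential G J T \<omega>) (Suc k) \<omega>))"
    by (simp add: ennreal_mult[symmetric] mult_ac ennreal_leI)
  also have "\<dots> \<le> ennreal (C powr s * (r ^ k * L) powr (s' - s)) *
      (SUP \<omega>\<in>cylinder G w. ennreal (exp (birkhoff_sum (\<lambda>\<omega>. s * potential G J T \<omega>) (Suc k) \<omega>)))"
    by (intro mult_left_mono SUP_upper \<omega>) simp
  finally show ?thesis using s w by (simp add: diam_power_def)
qed

lemma premeasure_limit_set_le:
  assumes s: "0 \<le> s" "s < s'" and d: "r ^ k * L \<le> d"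
  shows "hausdorff_premeasure s' d (limit_set G J T) \<le>
    ennreal (C powr s * (r ^ k * L) powr (s' - s)) *
      partition_sum G (\<lambda>\<omega>. s * potential G J T \<omega>) (Suc k)"
  unfolding partition_sum_def
proof (rule hausdorff_premeasure_le_infsum[OF countable_admissible_words limit_set_cover])
  show "0 \<le> d" using d L_nonneg r_bounds by (meson mult_nonneg_nonneg order_trans zero_le_power less_imp_le)
  fix w assume "w \<in> admissible_words G (Suc k)"
  then have w: "length w = Suc k" "cylinder G w \<noteq> {}" by (auto simp: admissible_words_def)
  show "bounded (coding G J T ` cylinder G w)" by (rule diameter_coding_cylinder(1)[OF w])
  show "diameter (coding G J T ` cylinder G w) \<le> d" using diameter_coding_cylinder(2)[OF w] d by simp
  show "diam_power s' (coding G J T ` cylinder G w) \<le>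
    ennreal (C powr s * (r ^ k * L) powr (s' - s)) *
      (SUP \<omega>\<in>cylinder G w. ennreal (exp (birkhoff_sum (\<lambda>\<omega>. s * potential G J T \<omega>) (Suc k) \<omega>)))"
    by (rule diam_power_coding_cylinder[OF s w])
qed

text \<open>
  With \<open>\<rho> = r powr ((s' - s) / 2) < 1\<close>, half of the gain \<open>r powr (k * (s' - s)) = \<rho> ^ (2 * k)\<close> absorbs the
  growth of the partition sums, which is eventually below \<open>(1 / \<rho>) ^ Suc k\<close>. What remains is a
  constant times \<open>\<rho> ^ k\<close>.
\<close>
lemma hausdorff_measure_limit_set_eq_0:
  assumes s: "0 \<le> s" "s < s'" and P: "pressure G (\<lambda>\<omega>. s * potential G J T \<omega>) \<le> 0"
  shows "hausdorff_measure s' (limit_set G J T) = 0"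
proof -
  let ?Z = "partition_sum G (\<lambda>\<omega>. s * potential G J T \<omega>)"
  define \<rho> where "\<rho> = r powr ((s' - s) / 2)"
  have "r powr ((s' - s) / 2) < 1 powr ((s' - s) / 2)" using r_bounds s by (intro powr_less_mono2) auto
  then have \<rho>: "0 < \<rho>" "\<rho> < 1" using r_bounds by (auto simp: \<rho>_def)
  have "limsup (\<lambda>n. log_ennreal (?Z n) / ereal (real n)) < ereal (- ln \<rho>)"
    using P \<rho> unfolding pressure_def by (auto intro: le_less_trans)
  then have "\<forall>\<^sub>F n in sequentially. log_ennreal (?Z n) / ereal (real n) < ereal (- ln \<rho>)"
    by (rule Limsup_lessD)
  then have "\<forall>\<^sub>F n in sequentially. ?Z n \<le> ennreal (exp (- ln \<rho> * real n))"
    using eventually_gt_at_top[of "0::nat"]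
    by eventually_elim (rule le_exp_if_log_ennreal_less)
  then have Z: "\<forall>\<^sub>F k in sequentially. ?Z (Suc k) \<le> ennreal (exp (- ln \<rho> * real (Suc k)))"
    using eventually_sequentially_Suc[of "\<lambda>n. ?Z n \<le> ennreal (exp (- ln \<rho> * real n))"] by blast
  have e: "exp (- ln \<rho> * real n) = 1 / \<rho> ^ n" for n
    using \<rho> by (simp add: exp_minus inverse_eq_divide mult.commute[of _ "real n"] exp_of_nat_mult del: of_nat_Suc)
  have decay: "(r ^ k * L) powr (s' - s) = (\<rho> * \<rho>) ^ k * L powr (s' - s)" for k
  proof -
    have "\<rho> * \<rho> = r powr (s' - s)" by (simp add: \<rho>_def powr_add[symmetric])
    moreover have "(r ^ k) powr (s' - s) = (r powr (s' - s)) ^ k"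
      using r_bounds by (simp add: powr_realpow[symmetric] powr_powr powr_power mult.commute)
    ultimately show ?thesis using L_nonneg r_bounds by (simp add: powr_mult)
  qed
  define D where "D = C powr s * L powr (s' - s) / \<rho>"
  have "hausdorff_premeasure s' d (limit_set G J T) \<le> 0" if d: "0 < d" for d
  proof (rule tendsto_lowerbound)
    have "(\<lambda>k. D * \<rho> ^ k) \<longlonglongrightarrow> D * 0" using \<rho> by (intro tendsto_intros LIMSEQ_realpow_zero) auto
    then show "(\<lambda>k. ennreal (D * \<rho> ^ k)) \<longlonglongrightarrow> 0" using tendsto_ennrealI by fastforce
    have "(\<lambda>k. r ^ k * L) \<longlonglongrightarrow> 0 * L" using r_bounds by (intro tendsto_intros LIMSEQ_realpow_zero) auto
    then have "\<forall>\<^sub>F k in sequentially. r ^ k * L < d" using d by (intro order_tendstoD(2)) auto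
    with Z show "\<forall>\<^sub>F k in sequentially. hausdorff_premeasure s' d (limit_set G J T) \<le> ennreal (D * \<rho> ^ k)"
    proof eventually_elim
      case (elim k)
      have "hausdorff_premeasure s' d (limit_set G J T) \<le>
          ennreal (C powr s * (r ^ k * L) powr (s' - s)) * ?Z (Suc k)"
        using elim by (intro premeasure_limit_set_le s) simp
      also have "\<dots> \<le> ennreal (C powr s * (r ^ k * L) powr (s' - s)) * ennreal (exp (- ln \<rho> * real (Suc k)))"
        using elim by (intro mult_left_mono) auto
      also have "\<dots> = ennreal (C powr s * (r ^ k * L) powr (s' - s) * (1 / \<rho> ^ Suc k))"
        unfolding e using \<rho> by (intro ennreal_mult[symmetric]) auto
      also have "C powr s * (r ^ k * L) powr (s' - s) * (1 / \<rho> ^ Suc k) = D * \<rho> ^ k"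
        unfolding decay D_def using \<rho> by (simp add: power_mult_distrib field_simps)
      finally show ?case .
    qed
  qed simp
  then show ?thesis unfolding hausdorff_measure_def by (simp add: SUP_eq_const le_zero_eq)
qed

lemma hausdorff_dim_limit_set_le:
  assumes "0 \<le> s" "pressure G (\<lambda>\<omega>. s * potential G J T \<omega>) \<le> 0"
  shows "hausdorff_dim (limit_set G J T) \<le> ereal s"
proof (rule ereal_le_epsilon2)
  fix e :: real assume e: "0 < e"
  then have "hausdorff_measure (s + e) (limit_set G J T) = 0"
    using assms by (intro hausdorff_measure_limit_set_eq_0) auto
  then show "hausdorff_dim (limit_set G J T) \<le> ereal s + ereal e"
    unfolding hausdorff_dim_def using e assms by (intro Inf_lower) auto
qed

lemma hausdorff_dim_limit_set_le_upper_exponent: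
  "hausdorff_dim (limit_set G J T) \<le> upper_exponent G J T"
  unfolding upper_exponent_def by (rule Inf_greatest) (auto intro: hausdorff_dim_limit_set_le)

end

lemma simple_gifs_imp_uniform_gifs:
  fixes G :: "('v, 'e) pre_digraph"
    and J U :: "'v \<Rightarrow> (real ^ 'n) set"
    and T :: "'e \<Rightarrow> real ^ 'n \<Rightarrow> real ^ 'n"
  assumes "simple_gifs G J U T" "bounded_distortion G U T" "contractible_J G J T"
  obtains B \<delta> r M c1 \<beta> c2 where "uniform_gifs G J U T B \<delta> r M c1 \<beta> c2"
proof -
  interpret simple_gifs G J U T by fact
  obtain B0 where B0: "\<And>v. v \<in> verts G \<Longrightarrow> diameter (J v) \<le> B0" using J_diameter by blast
  \<comment> \<open>Without vertices \<open>B0\<close> might be negative.\<close>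
  define B where "B = max B0 0"
  have B: "0 \<le> B" "\<And>v. v \<in> verts G \<Longrightarrow> diameter (J v) \<le> B" using B0 by (auto simp: B_def max_def intro: order_trans)
  obtain \<delta> where \<delta>: "0 < \<delta>" "\<And>v. v \<in> verts G \<Longrightarrow> \<delta> \<le> setdist (J v) (- U v)" using J_U_dist by blast
  have ball: "ball p \<delta> \<subseteq> U v" if v: "v \<in> verts G" and p: "p \<in> J v" for v p
  proof
    fix q assume q: "q \<in> ball p \<delta>"
    show "q \<in> U v"
    proof (rule ccontr)
      assume "q \<notin> U v"
      then have "setdist (J v) (- U v) \<le> dist p q" using p by (intro setdist_le_dist) auto
      with \<delta>(2)[OF v] q show False by simp
    qed
  qed
  obtain r where r: "0 < r" "r < 1" "\<And>e x. \<lbrakk>e \<in> arcs G; x \<in> U (head G e)\<rbrakk> \<Longrightarrow> deriv_norm (T e) x \<le> r"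
    using T_contracting by blast
  obtain M where M: "0 < M" and Mb: "\<And>J (f :: real ^ 'n \<Rightarrow> real ^ 'n) K x y.
      \<lbrakk>connected J; bounded J; diameter J \<le> B; 0 \<le> K;
       \<And>p q. \<lbrakk>p \<in> J; q \<in> J; dist p q < \<delta>\<rbrakk> \<Longrightarrow> dist (f p) (f q) \<le> K * dist p q;
       x \<in> J; y \<in> J\<rbrakk> \<Longrightarrow> dist (f x) (f y) \<le> K * (M * diameter J)"
    using locally_lipschitz_imp_diameter_bound[OF \<delta>(1), of B] by metis
  obtain c1 \<beta> where c1: "0 < c1" "0 < \<beta>"
    "\<And>e x y. \<lbrakk>e \<in> arcs G; x \<in> U (head G e); y \<in> U (head G e)\<rbrakk> \<Longrightarrow>
       \<bar>deriv_norm (T e) x - deriv_norm (T e) y\<bar> \<le> c1 * deriv_norm (T e) x * norm (x - y) powr \<beta>"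
    using assms(2) unfolding bounded_distortion_def by blast
  obtain c2 where c2: "0 < c2" "\<And>v. v \<in> verts G \<Longrightarrow> ennreal (diameter (J v)) \<le> ennreal c2 *
       (SUP e\<in>{e \<in> arcs G. tail G e = v}. SUP z\<in>J (head G e). ennreal (deriv_norm (T e) z))"
    using assms(3) unfolding contractible_J_def by blast
  have "uniform_gifs G J U T B \<delta> r M c1 \<beta> c2"
  proof
    fix v K x y and f :: "real ^ 'n \<Rightarrow> real ^ 'n"
    assume "v \<in> verts G" "0 \<le> K" "x \<in> J v" "y \<in> J v"
      "\<And>p q. \<lbrakk>p \<in> J v; q \<in> J v; dist p q < \<delta>\<rbrakk> \<Longrightarrow> dist (f p) (f q) \<le> K * dist p q"
    then show "dist (f x) (f y) \<le> K * (M * diameter (J v))"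
      using J_connected J_compact[THEN compact_imp_bounded] B(2) by (intro Mb[where f = f]) auto
  qed (fact B \<delta> ball r M c1 c2)+
  then show ?thesis by (rule that)
qed

theorem theorem3p4:
  fixes G :: "('v, 'e) pre_digraph"
    and J U :: "'v \<Rightarrow> (real ^ 'n) set"
    and T :: "'e \<Rightarrow> real ^ 'n \<Rightarrow> real ^ 'n"
  assumes "simple_gifs G J U T"
    and "bounded_distortion G U T"
    and "contractible_J G J T"
  shows "hausdorff_dim (limit_set G J T) \<le> max (upper_exponent G J T) (summability_exponent G J T)"
proof -
  obtain B \<delta> r M c1 \<beta> c2 where "uniform_gifs G J U T B \<delta> r M c1 \<beta> c2"
    using assms by (rule simple_gifs_imp_uniform_gifs)
  then have "hausdorff_dim (limit_set G J T) \<le> upper_exponent G J T"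
    by (rule uniform_gifs.hausdorff_dim_limit_set_le_upper_exponent)
  then show ?thesis by (simp add: le_max_iff_disj)
qed

end
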